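(* Let $(\mathcal{T},d)$ be a countable metric space, $t_0\in\mathcal{T}$, and let $X_1,\dots,X_n$ be independent random elements of $L_\infty(\mathcal{T})$, $X_i=(X_i(t))_{t\in\mathcal{T}}$. Let $S\in\mathbb{N}$, and let the sets $\mathcal{G}_s$, the maps $t\mapsto w(t,s)$, and the quantities $H_s$, $d_j(s)$, $\gamma_n(S)$, $R_n(S)$, $\bar X_n$, $\bar\delta_n$ be as in the context. Assume that for each $t,\tilde t\in\mathcal{T}$ and all $\lambda>0$, $$\mathbb{E}\exp\Big[\lambda\Big|\sum_{i=1}^n(X_i(t)-X_i(\tilde t))\Big|\Big]\le2\exp\Big[\frac{n\lambda^2d^2(t,\tilde t)}{2}\Big].$$ Then $$\mathbb{E}\|\bar X_n-\bar X_n(t_0)\|_\infty\le\gamma_n(S)+\sqrt{2R_n^2(S)/n}+\mathbb{E}\|\bar\delta_n(\cdot,S)\|_\infty .$$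
   Context: $\{\mathcal{G}_s\}_{s\in\mathbb{N}}$ is a sequence of finite non-empty subsets of $\mathcal{T}$ and $\mathcal{G}_0=\{t_0\}$. For $s=0,\dots,S$, $t\mapsto w(t,s)\in\mathcal{G}_s$ are maps defined on $\mathcal{T}$. Define $$H_s:=\log(2|\mathcal{G}_s|),\quad s=1,\dots,S,\qquad d_j(s):=d(w(j,s),w(j,s-1)),\quad j\in\mathcal{G}_S,\ s=1,\dots,S,$$ $$\gamma_n(S):=\max_{j\in\mathcal{G}_S}\sum_{s=1}^Sd_j(s)\sqrt{2(H_s+s\log2)/n},\qquad R_n(S):=\max_{j\in\mathcal{G}_S}\sum_{s=1}^Sd_j(s),$$ $$\bar X_n(t):=\frac1n\sum_{i=1}^nX_i(t),\qquad\bar\delta_n(t,S):=\bar X_n(t)-\bar X_n(w(t,S)).$$ For a function $f$ on $\mathcal{T}$, $\|f\|_\infty:=\sup_{t\in\mathcal{T}}|f(t)|$; thus $\|\bar X_n-\bar X_n(t_0)\|_\infty=\sup_{t\in\mathcal{T}}|\bar X_n(t)-\bar X_n(t_0)|$.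
   Formalization: Added hypothesis: for every t in T there is j in G_S with w(j,S)=w(t,S) (true e.g. if w(j,S)=j on G_S); without it the maxima over j in G_S can miss chains and the bound fails. *)

theory Defs
  imports "HOL-Probability.Probability"
begin

definition sup_norm_on :: "'a set \<Rightarrow> ('a \<Rightarrow> real) \<Rightarrow> real" where
  "sup_norm_on T f = (SUP t\<in>T. \<bar>f t\<bar>)"

text \<open>The elements of $L_\infty(T)$ are the bounded functions on \<open>T\<close>.  Since \<open>T\<close> is countable,
  a random element is a family of real random variables indexed by \<open>T\<close> whose sample paths are
  bounded.  The sigma-algebra is the one generated by the coordinates; it is contained in the
  Borel sigma-algebra of the sup norm, so measurability and independence with respect to the
  latter imply the conditions below.\<close>

definition indep_random_elements_Linf ::
  "'w measure \<Rightarrow> 'a set \<Rightarrow> nat set \<Rightarrow> (nat \<Rightarrow> 'w \<Rightarrow> 'a \<Rightarrow> real) \<Rightarrow> bool" where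
  "indep_random_elements_Linf M T I X \<longleftrightarrow>
     (\<forall>i\<in>I. \<forall>\<omega>\<in>space M. bounded (X i \<omega> ` T)) \<and>
     prob_space.indep_vars M (\<lambda>_. PiM T (\<lambda>_. borel)) (\<lambda>i \<omega>. restrict (X i \<omega>) T) I"

definition H_entropy :: "(nat \<Rightarrow> 'a set) \<Rightarrow> nat \<Rightarrow> real" where
  "H_entropy G s = ln (2 * real (card (G s)))"

definition link_dist :: "('a \<Rightarrow> 'a \<Rightarrow> real) \<Rightarrow> ('a \<Rightarrow> nat \<Rightarrow> 'a) \<Rightarrow> 'a \<Rightarrow> nat \<Rightarrow> real" where
  "link_dist d w j s = d (w j s) (w j (s - 1))"

definition gamma_chain ::
  "('a \<Rightarrow> 'a \<Rightarrow> real) \<Rightarrow> (nat \<Rightarrow> 'a set) \<Rightarrow> ('a \<Rightarrow> nat \<Rightarrow> 'a) \<Rightarrow> nat \<Rightarrow> nat \<Rightarrow> real" where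
  "gamma_chain d G w n S =
     Max ((\<lambda>j. \<Sum>s=1..S. link_dist d w j s *
                 sqrt (2 * (H_entropy G s + real s * ln 2) / real n)) ` G S)"

definition R_chain ::
  "('a \<Rightarrow> 'a \<Rightarrow> real) \<Rightarrow> (nat \<Rightarrow> 'a set) \<Rightarrow> ('a \<Rightarrow> nat \<Rightarrow> 'a) \<Rightarrow> nat \<Rightarrow> real" where
  "R_chain d G w S = Max ((\<lambda>j. \<Sum>s=1..S. link_dist d w j s) ` G S)"

text \<open>The maxima above only range over the chains that start at a point \<open>j \<in> G S\<close>.  They account
  for the chains of all points of \<open>T\<close> when every end point \<open>w t S\<close> is also the end point \<open>w j S\<close>
  of such a chain.  This holds in particular if \<open>w j S = j\<close> for all \<open>j \<in> G S\<close>.\<close>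

definition avg_process :: "(nat \<Rightarrow> 'w \<Rightarrow> 'a \<Rightarrow> real) \<Rightarrow> nat \<Rightarrow> 'w \<Rightarrow> 'a \<Rightarrow> real" where
  "avg_process X n \<omega> t = (1 / real n) * (\<Sum>i=1..n. X i \<omega> t)"

definition chain_remainder ::
  "(nat \<Rightarrow> 'w \<Rightarrow> 'a \<Rightarrow> real) \<Rightarrow> nat \<Rightarrow> ('a \<Rightarrow> nat \<Rightarrow> 'a) \<Rightarrow> nat \<Rightarrow> 'w \<Rightarrow> 'a \<Rightarrow> real" where
  "chain_remainder X n w S \<omega> t = avg_process X n \<omega> t - avg_process X n \<omega> (w t S)"

end

theory Submission
  imports Defs
begin

text \<open>
  By telescoping, \<open>|X\<^sub>n(w(t,S)) - X\<^sub>n(t\<^sub>0)|\<close> (sample averages) is bounded by the sum of the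
  increments along a chain, and each increment has a sub-Gaussian tail.  The union bound may use
  only \<open>|G\<^sub>s|\<close> links at level \<open>s\<close>, although a point of \<open>G\<^sub>s\<close> may have
  several predecessors \<open>w(j,s-1)\<close>.  So for each deviation level \<open>u\<close> the chains are replaced by
  shortest paths with respect to the link costs \<open>d\<^sub>j(s) sqrt (2 (H\<^sub>s + s log 2 + u\<^sup>2) / n)\<close>:
  these form a tree, and no chain becomes more expensive.  The maximum over the end points
  therefore exceeds \<open>\<gamma>\<^sub>n(S) + u sqrt (2 R\<^sub>n(S)\<^sup>2 / n)\<close> with probability at most
  \<open>(\<Sum>s\<ge>1. 2\<^sup>-\<^sup>s) exp (-u\<^sup>2) = exp (-u\<^sup>2)\<close>, and integrating over \<open>u\<close> gives the factor
  \<open>sqrt \<pi> / 2 \<le> 1\<close> for the second term.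
\<close>

text \<open>Layer-cake integration in the variable \<open>u\<close>: the excess of \<open>V\<close>
  over \<open>c\<close> is measured in units of \<open>a\<close>, and the Gaussian decay contributes
  at most \<open>sqrt pi / 2 \<le> 1\<close> such units. Negative values of \<open>V\<close> are cut
  off by \<open>ennreal\<close>.\<close>

lemma (in prob_space) nn_integral_le_if_gaussian_tail:
  fixes V :: "'a \<Rightarrow> real"
  assumes V [measurable]: "V \<in> borel_measurable M" and c: "c \<ge> 0" and a: "a \<ge> 0"
    and tail: "\<And>u. u \<ge> 0 \<Longrightarrow> prob {\<omega> \<in> space M. V \<omega> > c + a * u} \<le> exp (- u\<^sup>2)"
  shows "(\<integral>\<^sup>+ \<omega>. ennreal (V \<omega>) \<partial>M) \<le> ennreal (c + a)"
proof -
  \<comment> \<open>The rescaling divides by the slope, and \<open>a\<close> may be 0. A larger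
    slope \<open>b > 0\<close> keeps the tail bound; the passage from \<open>b\<close> down to
    \<open>a\<close> comes at the end.\<close>
  have pos: "(\<integral>\<^sup>+ \<omega>. ennreal (V \<omega>) \<partial>M) \<le> ennreal (c + b)" if b: "b > 0" "b \<ge> a" for b
  proof -
    interpret P: pair_sigma_finite M lborel ..
    let ?I = "\<lambda>\<omega> u. indicator {u. 0 \<le> u \<and> c + b * u < V \<omega>} u :: ennreal"
    have meas: "case_prod ?I \<in> borel_measurable (M \<Otimes>\<^sub>M lborel)"
      unfolding indicator_def by measurable
    \<comment> \<open>The positive part of \<open>V \<omega> - c\<close> is \<open>b\<close> times
      the length of the interval of all \<open>u \<ge> 0\<close> with
      \<open>c + b * u < V \<omega>\<close>.\<close>
    have point: "ennreal (V \<omega>) \<le> ennreal c + ennreal b * (\<integral>\<^sup>+ u. ?I \<omega> u \<partial>lborel)" for \<omega>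
    proof -
      have eq: "{u. 0 \<le> u \<and> c + b * u < V \<omega>} = {0..<(V \<omega> - c) / b}"
        using b by (auto simp: field_simps)
      have "(\<integral>\<^sup>+ u. ?I \<omega> u \<partial>lborel) = emeasure lborel {0..<(V \<omega> - c) / b}"
        unfolding eq by (subst nn_integral_indicator) auto
      then have "ennreal b * (\<integral>\<^sup>+ u. ?I \<omega> u \<partial>lborel) = ennreal (max 0 (V \<omega> - c))"
        using b by (cases "V \<omega> \<ge> c")
          (auto simp: ennreal_mult[symmetric] max_def field_simps divide_nonpos_pos)
      moreover have "ennreal (V \<omega>) \<le> ennreal (c + max 0 (V \<omega> - c))"
        by (intro ennreal_leI) simp
      moreover have "ennreal (c + max 0 (V \<omega> - c)) = ennreal c + ennreal (max 0 (V \<omega> - c))"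
        using c by (intro ennreal_plus) simp_all
      ultimately show ?thesis by (simp only:)
    qed
    have slice: "(\<integral>\<^sup>+ \<omega>. ?I \<omega> u \<partial>M) \<le> ennreal (indicator {0..} u *\<^sub>R exp (- u\<^sup>2))" for u
    proof (cases "u \<ge> 0")
      case True
      have "(\<integral>\<^sup>+ \<omega>. ?I \<omega> u \<partial>M) = (\<integral>\<^sup>+ \<omega>. indicator {\<omega> \<in> space M. V \<omega> > c + b * u} \<omega> \<partial>M)"
        using True by (intro nn_integral_cong) (auto simp: indicator_def)
      also have "\<dots> = emeasure M {\<omega> \<in> space M. V \<omega> > c + b * u}"
        by (subst nn_integral_indicator) auto
      also have "\<dots> \<le> emeasure M {\<omega> \<in> space M. V \<omega> > c + a * u}"
        using mult_right_mono[OF b(2) True] by (intro emeasure_mono) auto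
      also have "\<dots> \<le> ennreal (exp (- u\<^sup>2))"
        unfolding emeasure_eq_measure by (intro ennreal_leI tail True)
      finally show ?thesis using True by simp
    qed simp
    have "(\<integral>\<^sup>+ \<omega>. (\<integral>\<^sup>+ u. ?I \<omega> u \<partial>lborel) \<partial>M) = (\<integral>\<^sup>+ u. (\<integral>\<^sup>+ \<omega>. ?I \<omega> u \<partial>M) \<partial>lborel)"
      by (rule P.Fubini'[OF meas, symmetric])
    also have "\<dots> \<le> (\<integral>\<^sup>+ u. ennreal (indicator {0..} u *\<^sub>R exp (- u\<^sup>2)) \<partial>lborel)"
      by (intro nn_integral_mono slice)
    also have "\<dots> = ennreal (sqrt pi / 2)"
      using gaussian_moment_0
      by (subst nn_integral_eq_integral) (auto simp: has_bochner_integral_iff)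
    also have "\<dots> \<le> 1"
      using real_sqrt_le_mono[of pi 4] pi_less_4 by (simp add: ennreal_le_1)
    finally have gauss: "(\<integral>\<^sup>+ \<omega>. (\<integral>\<^sup>+ u. ?I \<omega> u \<partial>lborel) \<partial>M) \<le> 1" .
    have [measurable]: "(\<lambda>\<omega>. \<integral>\<^sup>+ u. ?I \<omega> u \<partial>lborel) \<in> borel_measurable M"
      by (rule lborel.borel_measurable_nn_integral[OF meas])
    have "(\<integral>\<^sup>+ \<omega>. ennreal (V \<omega>) \<partial>M)
        \<le> (\<integral>\<^sup>+ \<omega>. ennreal c + ennreal b * (\<integral>\<^sup>+ u. ?I \<omega> u \<partial>lborel) \<partial>M)"
      by (intro nn_integral_mono point)
    also have "\<dots> = ennreal c + ennreal b * (\<integral>\<^sup>+ \<omega>. (\<integral>\<^sup>+ u. ?I \<omega> u \<partial>lborel) \<partial>M)"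
      by (simp add: nn_integral_add nn_integral_cmult emeasure_space_1)
    also have "\<dots> \<le> ennreal c + ennreal b * 1"
      by (intro add_left_mono mult_left_mono gauss) auto
    finally show ?thesis using b c by simp
  qed
  show ?thesis
  proof (rule ennreal_le_epsilon)
    fix e :: real assume "e > 0"
    then show "(\<integral>\<^sup>+ \<omega>. ennreal (V \<omega>) \<partial>M) \<le> ennreal (c + a) + ennreal e"
      using pos[of "a + e"] a c by (simp add: ennreal_plus[symmetric] add.assoc del: ennreal_plus)
  qed
qed

text \<open>Chernoff's method: Markov's inequality for \<open>exp (r * Z)\<close> at the optimal
  \<open>r\<close>. The prefactor 2 of the moment bound passes to the tail.\<close>

lemma (in prob_space) subgaussian_tail:
  fixes Z :: "'a \<Rightarrow> real"
  assumes [measurable]: "Z \<in> borel_measurable M" and \<sigma>: "\<sigma> > 0" and x: "x > 0"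
    and mgf: "\<And>r. r > 0 \<Longrightarrow> (\<integral>\<^sup>+ \<omega>. ennreal (exp (r * Z \<omega>)) \<partial>M) \<le> ennreal (2 * exp (r\<^sup>2 * \<sigma>\<^sup>2 / 2))"
  shows "prob {\<omega> \<in> space M. Z \<omega> > \<sigma> * x} \<le> 2 * exp (- x\<^sup>2 / 2)"
proof -
  \<comment> \<open>This \<open>r\<close> minimises
    \<open>r\<^sup>2 * \<sigma>\<^sup>2 / 2 - r * \<sigma> * x\<close>, with minimum
    \<open>- x\<^sup>2 / 2\<close>.\<close>
  define r where "r = x / \<sigma>"
  have r: "r > 0" using \<sigma> x by (simp add: r_def)
  have "emeasure M {\<omega> \<in> space M. Z \<omega> > \<sigma> * x} \<le> emeasure M {\<omega> \<in> space M. Z \<omega> \<ge> \<sigma> * x}"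
    by (intro emeasure_mono) auto
  also have "\<dots> \<le> ennreal (exp (- r * (\<sigma> * x))) *
      (\<integral>\<^sup>+ \<omega>. ennreal (exp (r * Z \<omega>)) * indicator (space M) \<omega> \<partial>M)"
    by (rule Chernoff_ineq_nn_integral_ge[OF r]) auto
  also have "(\<integral>\<^sup>+ \<omega>. ennreal (exp (r * Z \<omega>)) * indicator (space M) \<omega> \<partial>M)
      = (\<integral>\<^sup>+ \<omega>. ennreal (exp (r * Z \<omega>)) \<partial>M)"
    by (intro nn_integral_cong) simp
  also have "ennreal (exp (- r * (\<sigma> * x))) * \<dots>
      \<le> ennreal (exp (- r * (\<sigma> * x))) * ennreal (2 * exp (r\<^sup>2 * \<sigma>\<^sup>2 / 2))"
    by (intro mult_left_mono mgf r) auto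
  also have "\<dots> = ennreal (2 * (exp (- r * (\<sigma> * x)) * exp (r\<^sup>2 * \<sigma>\<^sup>2 / 2)))"
    by (simp add: ennreal_mult[symmetric] mult_ac)
  also have "exp (- r * (\<sigma> * x)) * exp (r\<^sup>2 * \<sigma>\<^sup>2 / 2) = exp (- x\<^sup>2 / 2)"
    using \<sigma> unfolding exp_add[symmetric] r_def by (simp add: field_simps power2_eq_square)
  finally show ?thesis
    unfolding emeasure_eq_measure by (simp add: ennreal_le_iff)
qed

text \<open>
  The bound \<open>c\<close> depends only on the end point \<open>w j s\<close>, so that the number of links in the union
  bound is the number of points at each level and not the number of chains.
\<close>

lemma (in prob_space) chaining_tail_aux:
  fixes Y :: "'b \<Rightarrow> 'a \<Rightarrow> real" and d :: "'b \<Rightarrow> 'b \<Rightarrow> real"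
    and h q :: "nat \<Rightarrow> real"
  assumes meas: "\<And>t. t \<in> T \<Longrightarrow> Y t \<in> borel_measurable M"
    and J: "finite J"
    and wT: "\<And>j s. j \<in> J \<Longrightarrow> s \<le> S \<Longrightarrow> w j s \<in> T"
    and w0: "\<And>j. j \<in> J \<Longrightarrow> w j 0 = t0" and t0: "t0 \<in> T"
    and tail: "\<And>s t t'. s \<in> {1..S} \<Longrightarrow> t \<in> T \<Longrightarrow> t' \<in> T \<Longrightarrow>
      prob {\<omega> \<in> space M. \<bar>Y t \<omega> - Y t' \<omega>\<bar> > d t t' * h s} \<le> q s"
  shows "s \<le> S \<Longrightarrow> \<exists>c. (\<forall>j\<in>J. c (w j s) \<le> (\<Sum>r=1..s. d (w j r) (w j (r - 1)) * h r)) \<and>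
    prob {\<omega> \<in> space M. \<exists>j\<in>J. \<bar>Y (w j s) \<omega> - Y t0 \<omega>\<bar> > c (w j s)}
      \<le> (\<Sum>r=1..s. real (card ((\<lambda>j. w j r) ` J)) * q r)"
proof (induction s)
  case 0
  show ?case by (intro exI[of _ "\<lambda>_. 0"]) (simp add: w0)
next
  case (Suc s)
  then have s: "s \<le> S" by simp
  from Suc.IH[OF s] obtain c where
    c_le: "\<And>j. j \<in> J \<Longrightarrow> c (w j s) \<le> (\<Sum>r=1..s. d (w j r) (w j (r - 1)) * h r)" and
    c_prob: "prob {\<omega> \<in> space M. \<exists>j\<in>J. \<bar>Y (w j s) \<omega> - Y t0 \<omega>\<bar> > c (w j s)}
      \<le> (\<Sum>r=1..s. real (card ((\<lambda>j. w j r) ` J)) * q r)" by blast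
  \<comment> \<open>One step of the shortest-path recursion: \<open>cost j\<close> extends the bound
    attached to \<open>w j s\<close> by the last link of chain \<open>j\<close>, and
    \<open>k p\<close> picks a chain through which \<open>p\<close> is reached most cheaply.\<close>
  define cost where "cost j = c (w j s) + d (w j (Suc s)) (w j s) * h (Suc s)" for j
  define A where "A p = {j \<in> J. w j (Suc s) = p}" for p
  define k where "k p = arg_min_on cost (A p)" for p
  define L where "L = (\<lambda>j. w j (Suc s)) ` J"
  have k: "k p \<in> J" "w (k p) (Suc s) = p" "\<And>j. j \<in> A p \<Longrightarrow> cost (k p) \<le> cost j"
    if "p \<in> L" for p
  proof -
    have A: "finite (A p)" "A p \<noteq> {}" using J that by (auto simp: A_def L_def)
    show "k p \<in> J" "w (k p) (Suc s) = p"
      using arg_min_if_finite(1)[OF A, of cost] by (auto simp: k_def A_def)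
    show "cost (k p) \<le> cost j" if "j \<in> A p" for j
      using arg_min_least[OF A that] by (simp add: k_def)
  qed
  have L: "finite L" "L \<subseteq> T" using J wT Suc.prems by (auto simp: L_def)
  have meas' [measurable]: "Y (w j s) \<in> borel_measurable M" "Y (w j (Suc s)) \<in> borel_measurable M"
    if "j \<in> J" for j
    using that meas wT s Suc.prems by auto
  have [measurable]: "Y t0 \<in> borel_measurable M" using meas t0 .
  define E where "E = {\<omega> \<in> space M. \<exists>j\<in>J. \<bar>Y (w j s) \<omega> - Y t0 \<omega>\<bar> > c (w j s)}"
  \<comment> \<open>Only the link chosen by \<open>k p\<close> is tested, which gives one event per
    point of \<open>L\<close>, however many chains end there.\<close>
  define F where "F p = {\<omega> \<in> space M. \<bar>Y p \<omega> - Y (w (k p) s) \<omega>\<bar> > d p (w (k p) s) * h (Suc s)}"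
    for p
  have E: "E \<in> events"
    unfolding E_def using J by measurable
  have F: "F p \<in> events" if "p \<in> L" for p
  proof -
    have [measurable]: "Y p \<in> borel_measurable M" "Y (w (k p) s) \<in> borel_measurable M"
      using L(2) that meas meas'(1)[OF k(1)[OF that]] by auto
    show ?thesis unfolding F_def by measurable
  qed
  have F_prob: "prob (F p) \<le> q (Suc s)" if "p \<in> L" for p
    unfolding F_def using L(2) that k(1)[OF that] wT s Suc.prems by (intro tail) auto
  \<comment> \<open>If the link into \<open>p\<close> stays within its cost, the triangle inequality
    pushes the excess back to \<open>w (k p) s\<close>. This point need not lie on chain
    \<open>j\<close>, which is why the induction attaches bounds to points.\<close>
  have sub: "{\<omega> \<in> space M. \<exists>j\<in>J. \<bar>Y (w j (Suc s)) \<omega> - Y t0 \<omega>\<bar> > cost (k (w j (Suc s)))}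
      \<subseteq> E \<union> (\<Union>p\<in>L. F p)"
  proof safe
    fix \<omega> j assume \<omega>: "\<omega> \<in> space M" and j: "j \<in> J"
      and gt: "\<bar>Y (w j (Suc s)) \<omega> - Y t0 \<omega>\<bar> > cost (k (w j (Suc s)))"
      and notF: "\<omega> \<notin> (\<Union>p\<in>L. F p)"
    define p where "p = w j (Suc s)"
    have p: "p \<in> L" using j by (auto simp: L_def p_def)
    have "\<bar>Y p \<omega> - Y (w (k p) s) \<omega>\<bar> \<le> d p (w (k p) s) * h (Suc s)"
      using notF p \<omega> by (force simp: F_def)
    then have "\<bar>Y (w (k p) s) \<omega> - Y t0 \<omega>\<bar> > c (w (k p) s)"
      using gt k(2)[OF p] unfolding p_def[symmetric] cost_def by simp
    then show "\<omega> \<in> E" using \<omega> k(1)[OF p] by (auto simp: E_def)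
  qed
  have "prob {\<omega> \<in> space M. \<exists>j\<in>J. \<bar>Y (w j (Suc s)) \<omega> - Y t0 \<omega>\<bar> > cost (k (w j (Suc s)))}
      \<le> prob (E \<union> (\<Union>p\<in>L. F p))"
    using E F L by (intro finite_measure_mono sub) auto
  also have "\<dots> \<le> prob E + prob (\<Union>p\<in>L. F p)"
    using E F L by (intro measure_Un_le) auto
  also have "prob (\<Union>p\<in>L. F p) \<le> (\<Sum>p\<in>L. prob (F p))"
    using F L by (intro finite_measure_subadditive_finite) auto
  also have "\<dots> \<le> (\<Sum>p\<in>L. q (Suc s))"
    by (intro sum_mono F_prob)
  also have "\<dots> = real (card ((\<lambda>j. w j (Suc s)) ` J)) * q (Suc s)"
    by (simp add: L_def)
  finally have prob: "prob {\<omega> \<in> space M. \<exists>j\<in>J.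
      \<bar>Y (w j (Suc s)) \<omega> - Y t0 \<omega>\<bar> > cost (k (w j (Suc s)))}
      \<le> (\<Sum>r=1..Suc s. real (card ((\<lambda>j. w j r) ` J)) * q r)"
    using c_prob by (simp add: E_def)
  \<comment> \<open>Chain \<open>j\<close> itself competes in the minimisation that defines
    \<open>k (w j (Suc s))\<close>.\<close>
  have "cost (k (w j (Suc s))) \<le> (\<Sum>r=1..Suc s. d (w j r) (w j (r - 1)) * h r)" if "j \<in> J" for j
  proof -
    have "cost (k (w j (Suc s))) \<le> cost j"
      using that by (intro k(3)) (auto simp: L_def A_def)
    also have "\<dots> \<le> (\<Sum>r=1..Suc s. d (w j r) (w j (r - 1)) * h r)"
      using c_le[OF that] by (simp add: cost_def)
    finally show ?thesis .
  qed
  with prob show ?case by (intro exI[of _ "\<lambda>p. cost (k p)"]) blast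
qed

text \<open>The bounds attached to points lie below the costs of the given chains, so exceeding the
  latter implies exceeding the former. This returns to costs that \<open>gamma_chain\<close> and
  \<open>R_chain\<close> control.\<close>

lemma (in prob_space) chaining_tail:
  fixes Y :: "'b \<Rightarrow> 'a \<Rightarrow> real" and d :: "'b \<Rightarrow> 'b \<Rightarrow> real"
    and h q :: "nat \<Rightarrow> real"
  assumes meas: "\<And>t. t \<in> T \<Longrightarrow> Y t \<in> borel_measurable M"
    and J: "finite J"
    and wT: "\<And>j s. j \<in> J \<Longrightarrow> s \<le> S \<Longrightarrow> w j s \<in> T"
    and w0: "\<And>j. j \<in> J \<Longrightarrow> w j 0 = t0" and t0: "t0 \<in> T"
    and tail: "\<And>s t t'. s \<in> {1..S} \<Longrightarrow> t \<in> T \<Longrightarrow> t' \<in> T \<Longrightarrow>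
      prob {\<omega> \<in> space M. \<bar>Y t \<omega> - Y t' \<omega>\<bar> > d t t' * h s} \<le> q s"
  shows "prob {\<omega> \<in> space M. \<exists>j\<in>J. \<bar>Y (w j S) \<omega> - Y t0 \<omega>\<bar>
        > (\<Sum>r=1..S. d (w j r) (w j (r - 1)) * h r)}
      \<le> (\<Sum>r=1..S. real (card ((\<lambda>j. w j r) ` J)) * q r)"
proof -
  obtain c where
    c_le: "\<And>j. j \<in> J \<Longrightarrow> c (w j S) \<le> (\<Sum>r=1..S. d (w j r) (w j (r - 1)) * h r)" and
    c_prob: "prob {\<omega> \<in> space M. \<exists>j\<in>J. \<bar>Y (w j S) \<omega> - Y t0 \<omega>\<bar> > c (w j S)}
      \<le> (\<Sum>r=1..S. real (card ((\<lambda>j. w j r) ` J)) * q r)"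
    using chaining_tail_aux[of T Y J S w t0 d h q, OF assms order_refl] by blast
  have [measurable]: "Y t0 \<in> borel_measurable M"
    "\<And>j. j \<in> J \<Longrightarrow> Y (w j S) \<in> borel_measurable M"
    using meas t0 wT by auto
  have "prob {\<omega> \<in> space M. \<exists>j\<in>J. \<bar>Y (w j S) \<omega> - Y t0 \<omega>\<bar>
        > (\<Sum>r=1..S. d (w j r) (w j (r - 1)) * h r)}
      \<le> prob {\<omega> \<in> space M. \<exists>j\<in>J. \<bar>Y (w j S) \<omega> - Y t0 \<omega>\<bar> > c (w j S)}"
  proof (rule finite_measure_mono)
    show "{\<omega> \<in> space M. \<exists>j\<in>J. \<bar>Y (w j S) \<omega> - Y t0 \<omega>\<bar> > c (w j S)} \<in> events"
      using J by measurable
  qed (use c_le in \<open>auto intro: le_less_trans\<close>)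
  with c_prob show ?thesis by linarith
qed

lemma sum_half_powers_le_1: "(\<Sum>r=1..S. (1 / 2 :: real) ^ r) \<le> 1"
proof -
  have "(\<Sum>r=1..S. (1 / 2 :: real) ^ r) = 1 - (1 / 2) ^ S"
    by (induction S) auto
  then show ?thesis by simp
qed

text \<open>Expectations are integrals in \<open>ennreal\<close>, so the inequality also makes sense
  when the expected remainder is infinite.\<close>

theorem theorem3p6p1:
  fixes M :: "'w measure"
    and T :: "'a set" and d :: "'a \<Rightarrow> 'a \<Rightarrow> real" and t0 :: 'a
    and X :: "nat \<Rightarrow> 'w \<Rightarrow> 'a \<Rightarrow> real"
    and n S :: nat
    and G :: "nat \<Rightarrow> 'a set" and w :: "'a \<Rightarrow> nat \<Rightarrow> 'a"
  assumes "prob_space M"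
    and "Metric_space T d" and "countable T" and "t0 \<in> T"
    and "n \<ge> 1"
    and "indep_random_elements_Linf M T {1..n} X"
    and "\<And>s. finite (G s) \<and> G s \<noteq> {} \<and> G s \<subseteq> T"
    and "G 0 = {t0}"
    and "\<And>t s. t \<in> T \<Longrightarrow> s \<le> S \<Longrightarrow> w t s \<in> G s"
    and "\<And>t. t \<in> T \<Longrightarrow> \<exists>j\<in>G S. w j S = w t S"
    and "\<And>t t' r. t \<in> T \<Longrightarrow> t' \<in> T \<Longrightarrow> r > 0 \<Longrightarrow>
           (\<integral>\<^sup>+ \<omega>. ennreal (exp (r * \<bar>\<Sum>i=1..n. (X i \<omega> t - X i \<omega> t')\<bar>)) \<partial>M)
             \<le> ennreal (2 * exp (real n * r\<^sup>2 * (d t t')\<^sup>2 / 2))"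
  shows "(\<integral>\<^sup>+ \<omega>. ennreal (sup_norm_on T (\<lambda>t. avg_process X n \<omega> t - avg_process X n \<omega> t0)) \<partial>M)
    \<le> ennreal (gamma_chain d G w n S + sqrt (2 * (R_chain d G w S)\<^sup>2 / real n))
      + (\<integral>\<^sup>+ \<omega>. ennreal (sup_norm_on T (chain_remainder X n w S \<omega>)) \<partial>M)"
proof -
  interpret prob_space M by fact
  interpret Metric_space T d by fact
  note n = \<open>n \<ge> 1\<close> and t0 = \<open>t0 \<in> T\<close>
  note G = assms(7) and G0 = assms(8) and wG = assms(9) and cover = assms(10) and mgf = assms(11)
  define Y where "Y t \<omega> = avg_process X n \<omega> t" for t \<omega>
  define W where "W \<omega> = Max ((\<lambda>j. \<bar>Y (w j S) \<omega> - Y t0 \<omega>\<bar>) ` G S)" for \<omega>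
  define \<gamma> where "\<gamma> = gamma_chain d G w n S"
  define R where "R = R_chain d G w S"
  define a where "a = sqrt (2 * R\<^sup>2 / real n)"

  \<comment> \<open>Sample paths and measurability of the averages\<close>
  have bdd: "\<And>i \<omega>. i \<in> {1..n} \<Longrightarrow> \<omega> \<in> space M \<Longrightarrow> bounded (X i \<omega> ` T)"
    and rv: "\<And>i. i \<in> {1..n} \<Longrightarrow> (\<lambda>\<omega>. restrict (X i \<omega>) T) \<in> measurable M (PiM T (\<lambda>_. borel))"
    using assms(6) by (auto simp: indep_random_elements_Linf_def indep_vars_def)
  have fin: "finite (G S)" "G S \<noteq> {}" and GT: "\<And>s. G s \<subseteq> T"
    using G by auto
  have wT: "w t s \<in> T" if "t \<in> T" "s \<le> S" for t s
    using wG[OF that] GT by auto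
  have w0: "w j 0 = t0" if "j \<in> T" for j
    using wG[OF that, of 0] G0 by simp
  have X_meas: "(\<lambda>\<omega>. X i \<omega> t) \<in> borel_measurable M" if "i \<in> {1..n}" "t \<in> T" for i t
    using measurable_component_singleton[OF that(2), THEN measurable_compose[OF rv[OF that(1)]]]
      that(2) by simp
  have Y_meas: "Y t \<in> borel_measurable M" if "t \<in> T" for t
    unfolding Y_def avg_process_def
    using X_meas that by (intro borel_measurable_times borel_measurable_sum) auto
  have Y_diff: "Y t \<omega> - Y t' \<omega> = (\<Sum>i=1..n. (X i \<omega> t - X i \<omega> t')) / real n" for t t' \<omega>
    by (simp add: Y_def avg_process_def sum_subtractf diff_divide_distrib)

  \<comment> \<open>Sub-Gaussian tails of the increments\<close>
  have tail: "prob {\<omega> \<in> space M. \<bar>Y t \<omega> - Y t' \<omega>\<bar> > d t t' * sqrt (2 * x / real n)} \<le> 2 * exp (- x)"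
    if t: "t \<in> T" "t' \<in> T" and x: "x > 0" for t t' x
  \<comment> \<open>The Chernoff bound requires a positive scale. For \<open>t = t'\<close> the
    increment and its threshold are both 0.\<close>
  proof (cases "t = t'")
    case True
    then show ?thesis using t by simp
  next
    case False
    have [measurable]: "(\<lambda>\<omega>. \<bar>Y t \<omega> - Y t' \<omega>\<bar>) \<in> borel_measurable M"
      using Y_meas[OF t(1)] Y_meas[OF t(2)] by measurable
    \<comment> \<open>Averaging turns the scale into \<open>d t t' / sqrt (real n)\<close>, and the
      argument \<open>sqrt (2 * x)\<close> makes the exponent equal to \<open>- x\<close>.\<close>
    have "prob {\<omega> \<in> space M. \<bar>Y t \<omega> - Y t' \<omega>\<bar> > d t t' / sqrt (real n) * sqrt (2 * x)}
        \<le> 2 * exp (- (sqrt (2 * x))\<^sup>2 / 2)"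
    proof (rule subgaussian_tail)
      fix r :: real assume r: "r > 0"
      have "(\<integral>\<^sup>+ \<omega>. ennreal (exp (r * \<bar>Y t \<omega> - Y t' \<omega>\<bar>)) \<partial>M)
          = (\<integral>\<^sup>+ \<omega>. ennreal (exp (r / real n * \<bar>\<Sum>i=1..n. (X i \<omega> t - X i \<omega> t')\<bar>)) \<partial>M)"
        by (simp add: Y_diff)
      also have "\<dots> \<le> ennreal (2 * exp (real n * (r / real n)\<^sup>2 * (d t t')\<^sup>2 / 2))"
        using r n by (intro mgf t) auto
      also have "real n * (r / real n)\<^sup>2 * (d t t')\<^sup>2 / 2 = r\<^sup>2 * (d t t' / sqrt (real n))\<^sup>2 / 2"
        using n by (simp add: field_simps power2_eq_square)
      finally show "(\<integral>\<^sup>+ \<omega>. ennreal (exp (r * \<bar>Y t \<omega> - Y t' \<omega>\<bar>)) \<partial>M)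
          \<le> ennreal (2 * exp (r\<^sup>2 * (d t t' / sqrt (real n))\<^sup>2 / 2))" .
    qed (use False t x n mdist_pos_less in auto)
    then show ?thesis using x by (simp add: real_sqrt_divide)
  qed

  \<comment> \<open>Entropy weights and signs of the chain constants\<close>
  define b where "b s = H_entropy G s + real s * ln 2" for s
  have card_pos: "card (G s) \<ge> 1" for s using G[of s] by (simp add: Suc_le_eq card_gt_0_iff)
  have b_pos: "b s > 0" for s
  proof -
    have "H_entropy G s > 0" unfolding H_entropy_def using card_pos[of s] by (intro ln_gt_zero) simp
    then show ?thesis by (simp add: b_def add_pos_nonneg)
  qed
  have link_nonneg: "link_dist d w j s \<ge> 0" for j s
    by (simp add: link_dist_def)
  have le_gamma: "(\<Sum>s=1..S. link_dist d w j s * sqrt (2 * b s / real n)) \<le> \<gamma>" if "j \<in> G S" for j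
    unfolding \<gamma>_def gamma_chain_def b_def using that fin by (intro Max_ge) auto
  have le_R: "(\<Sum>s=1..S. link_dist d w j s) \<le> R" if "j \<in> G S" for j
    unfolding R_def R_chain_def using that fin by (intro Max_ge) auto
  \<comment> \<open>A single chain shows that the maxima are nonnegative; for \<open>R\<close> this
    allows \<open>sqrt (R\<^sup>2) = R\<close> in \<open>a_eq\<close>.\<close>
  obtain j0 where j0: "j0 \<in> G S" using fin by blast
  have R_nonneg: "R \<ge> 0"
    by (rule order.trans[OF sum_nonneg le_R[OF j0]]) (rule link_nonneg)
  have gamma_nonneg: "\<gamma> \<ge> 0"
    using b_pos by (intro order.trans[OF sum_nonneg le_gamma[OF j0]] mult_nonneg_nonneg link_nonneg)
      (simp add: less_imp_le)
  have a_eq: "a = R * sqrt (2 / real n)"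
    using R_nonneg by (simp add: a_def real_sqrt_mult real_sqrt_divide)

  \<comment> \<open>Gaussian tail of the maximum over the end points\<close>
  have W_tail: "prob {\<omega> \<in> space M. W \<omega> > \<gamma> + a * u} \<le> exp (- u\<^sup>2)" if u: "u \<ge> 0" for u
  proof -
    define h where "h s = sqrt (2 * (b s + u\<^sup>2) / real n)" for s
    \<comment> \<open>Subadditivity of the square root splits off a term linear in \<open>u\<close>
      whose slope does not depend on \<open>s\<close>. Summed along a chain, the two terms are
      bounded by \<open>\<gamma>\<close> and \<open>a * u\<close>.\<close>
    have h_le: "h s \<le> sqrt (2 * b s / real n) + sqrt (2 / real n) * u" for s
    proof -
      have "h s = sqrt (2 * b s / real n + 2 / real n * u\<^sup>2)"
        by (simp add: h_def add_divide_distrib distrib_left)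
      also have "\<dots> \<le> sqrt (2 * b s / real n) + sqrt (2 / real n * u\<^sup>2)"
        using b_pos[of s] by (intro sqrt_add_le_add_sqrt) auto
      finally show ?thesis using u by (simp only: real_sqrt_mult real_sqrt_abs abs_of_nonneg)
    qed
    have cost_le: "(\<Sum>s=1..S. d (w j s) (w j (s - 1)) * h s) \<le> \<gamma> + a * u" if j: "j \<in> G S" for j
    proof -
      have "(\<Sum>s=1..S. d (w j s) (w j (s - 1)) * h s)
          \<le> (\<Sum>s=1..S. link_dist d w j s * (sqrt (2 * b s / real n) + sqrt (2 / real n) * u))"
        unfolding link_dist_def by (intro sum_mono mult_left_mono h_le) simp
      also have "\<dots> = (\<Sum>s=1..S. link_dist d w j s * sqrt (2 * b s / real n))
          + (\<Sum>s=1..S. link_dist d w j s) * (sqrt (2 / real n) * u)"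
        by (simp only: distrib_left sum.distrib sum_distrib_right)
      also have "\<dots> \<le> \<gamma> + R * (sqrt (2 / real n) * u)"
        using u by (intro add_mono le_gamma j mult_right_mono le_R) simp
      finally show ?thesis by (simp add: a_eq mult.assoc)
    qed
    have [measurable]: "Y t0 \<in> borel_measurable M"
      "\<And>j. j \<in> G S \<Longrightarrow> Y (w j S) \<in> borel_measurable M"
      using Y_meas t0 wT GT by (blast+)
    have "prob {\<omega> \<in> space M. W \<omega> > \<gamma> + a * u}
        \<le> prob {\<omega> \<in> space M. \<exists>j\<in>G S. \<bar>Y (w j S) \<omega> - Y t0 \<omega>\<bar>
          > (\<Sum>s=1..S. d (w j s) (w j (s - 1)) * h s)}"
    proof (rule finite_measure_mono)
      show "{\<omega> \<in> space M. W \<omega> > \<gamma> + a * u} \<subseteq> {\<omega> \<in> space M. \<exists>j\<in>G S.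
          \<bar>Y (w j S) \<omega> - Y t0 \<omega>\<bar> > (\<Sum>s=1..S. d (w j s) (w j (s - 1)) * h s)}"
        using fin cost_le by (auto simp: W_def Max_gr_iff intro: le_less_trans)
      show "{\<omega> \<in> space M. \<exists>j\<in>G S. \<bar>Y (w j S) \<omega> - Y t0 \<omega>\<bar>
          > (\<Sum>s=1..S. d (w j s) (w j (s - 1)) * h s)} \<in> events"
        using fin(1) by measurable
    qed
    also have "\<dots> \<le> (\<Sum>s=1..S. real (card ((\<lambda>j. w j s) ` G S)) * (2 * exp (- (b s + u\<^sup>2))))"
    proof (rule chaining_tail[where T = T])
      show "prob {\<omega> \<in> space M. \<bar>Y t \<omega> - Y t' \<omega>\<bar> > d t t' * h s} \<le> 2 * exp (- (b s + u\<^sup>2))"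
        if "t \<in> T" "t' \<in> T" for s t t'
        unfolding h_def using that b_pos[of s] by (intro tail) (auto intro: add_pos_nonneg)
    qed (use Y_meas fin wT w0 t0 GT[of S] in auto)
    also have "\<dots> \<le> (\<Sum>s=1..S. (1 / 2) ^ s * exp (- u\<^sup>2))"
    proof (rule sum_mono)
      fix s assume s: "s \<in> {1..S}"
      have "card ((\<lambda>j. w j s) ` G S) \<le> card (G s)"
        using s G[of s] wG GT by (intro card_mono) auto
      then have "real (card ((\<lambda>j. w j s) ` G S)) * (2 * exp (- (b s + u\<^sup>2)))
          \<le> real (card (G s)) * (2 * exp (- (b s + u\<^sup>2)))"
        by (intro mult_right_mono) auto
      \<comment> \<open>Each part of \<open>b s\<close> pays for one factor: within
        \<open>H_entropy G s\<close>, the 2 under the logarithm cancels the prefactor of the tail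
        and \<open>card (G s)\<close> cancels the number of links; \<open>real s * ln 2\<close>
        leaves the summable weight.\<close>
      also have "\<dots> = (1 / 2) ^ s * exp (- u\<^sup>2)"
      proof -
        have "exp (- (b s + u\<^sup>2)) = exp (- u\<^sup>2) / (2 * real (card (G s)) * 2 ^ s)"
          using card_pos[of s]
          by (simp add: b_def H_entropy_def exp_diff exp_add exp_minus exp_of_nat_mult field_simps)
        then show ?thesis
          using card_pos[of s] by (simp add: field_simps power_divide)
      qed
      finally show "real (card ((\<lambda>j. w j s) ` G S)) * (2 * exp (- (b s + u\<^sup>2)))
          \<le> (1 / 2) ^ s * exp (- u\<^sup>2)" .
    qed
    also have "\<dots> = (\<Sum>s=1..S. (1 / 2) ^ s) * exp (- u\<^sup>2)"
      by (simp add: sum_distrib_right)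
    also have "\<dots> \<le> 1 * exp (- u\<^sup>2)"
      by (intro mult_right_mono sum_half_powers_le_1) simp
    finally show ?thesis by simp
  qed

  have W_meas [measurable]: "W \<in> borel_measurable M"
  proof -
    have "(\<lambda>\<omega>. \<bar>Y (w j S) \<omega> - Y t0 \<omega>\<bar>) \<in> borel_measurable M" if "j \<in> G S" for j
    proof -
      have [measurable]: "Y (w j S) \<in> borel_measurable M" "Y t0 \<in> borel_measurable M"
        using Y_meas t0 wT GT that by blast+
      show ?thesis by measurable
    qed
    then show ?thesis unfolding W_def by (intro borel_measurable_Max fin)
  qed
  have W_nonneg: "W \<omega> \<ge> 0" for \<omega>
    unfolding W_def using fin j0 by (intro order.trans[OF abs_ge_zero Max_ge]) auto
  have EW: "(\<integral>\<^sup>+ \<omega>. ennreal (W \<omega>) \<partial>M) \<le> ennreal (\<gamma> + a)"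
    using W_tail by (intro nn_integral_le_if_gaussian_tail gamma_nonneg) (auto simp: a_def)

  \<comment> \<open>The remainder process\<close>
  define D where "D \<omega> = sup_norm_on T (chain_remainder X n w S \<omega>)" for \<omega>
  have D_eq: "D \<omega> = (SUP t\<in>T. \<bar>Y t \<omega> - Y (w t S) \<omega>\<bar>)" for \<omega>
    by (simp add: D_def sup_norm_on_def chain_remainder_def Y_def)
  \<comment> \<open>A real \<open>SUP\<close> is an upper bound only for sets bounded above; bounded
    sample paths give this for each fixed \<open>\<omega>\<close>.\<close>
  have D_bdd: "bdd_above ((\<lambda>t. \<bar>Y t \<omega> - Y (w t S) \<omega>\<bar>) ` T)" if \<omega>: "\<omega> \<in> space M" for \<omega>
  proof -
    have "\<exists>B. \<forall>i\<in>{1..n}. \<forall>t\<in>T. \<bar>X i \<omega> t\<bar> \<le> B i"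
      using bdd[OF _ \<omega>] by (intro bchoice) (auto simp: bounded_iff)
    then obtain B where B: "\<And>i t. i \<in> {1..n} \<Longrightarrow> t \<in> T \<Longrightarrow> \<bar>X i \<omega> t\<bar> \<le> B i"
      by blast
    have Y_le: "\<bar>Y t \<omega>\<bar> \<le> (\<Sum>i=1..n. B i) / real n" if "t \<in> T" for t
    proof -
      have "\<bar>\<Sum>i=1..n. X i \<omega> t\<bar> \<le> (\<Sum>i=1..n. B i)"
        using B that by (intro order.trans[OF sum_abs] sum_mono) auto
      then show ?thesis
        by (simp add: Y_def avg_process_def divide_right_mono)
    qed
    show ?thesis
    proof (rule bdd_aboveI2)
      fix t assume "t \<in> T"
      then show "\<bar>Y t \<omega> - Y (w t S) \<omega>\<bar> \<le> 2 * ((\<Sum>i=1..n. B i) / real n)"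
        using Y_le[of t] Y_le[of "w t S"] wT[of t S] by linarith
    qed
  qed
  have D_nonneg: "D \<omega> \<ge> 0" if "\<omega> \<in> space M" for \<omega>
    unfolding D_eq by (rule cSUP_upper2[OF D_bdd[OF that] t0]) simp
  have D_meas [measurable]: "D \<in> borel_measurable M"
  proof -
    have "(\<lambda>\<omega>. \<bar>Y t \<omega> - Y (w t S) \<omega>\<bar>) \<in> borel_measurable M" if "t \<in> T" for t
    proof -
      have [measurable]: "Y t \<in> borel_measurable M" "Y (w t S) \<in> borel_measurable M"
        using Y_meas wT that by blast+
      show ?thesis by measurable
    qed
    \<comment> \<open>Countability of \<open>T\<close> makes the supremum measurable.\<close>
    then show ?thesis
      unfolding D_eq[abs_def] using D_bdd \<open>countable T\<close> by (intro borel_measurable_cSUP) auto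
  qed

  \<comment> \<open>Pathwise bound and expectations\<close>
  have "sup_norm_on T (\<lambda>t. avg_process X n \<omega> t - avg_process X n \<omega> t0) \<le> W \<omega> + D \<omega>"
    if \<omega>: "\<omega> \<in> space M" for \<omega>
    unfolding sup_norm_on_def Y_def[symmetric]
  proof (rule cSUP_least)
    fix t assume t: "t \<in> T"
    \<comment> \<open>\<open>W\<close> sees only the points \<open>w j S\<close> with
      \<open>j \<in> G S\<close>; the covering assumption provides such a \<open>j\<close> for the
      end point of \<open>t\<close>.\<close>
    obtain j where j: "j \<in> G S" "w j S = w t S" using cover[OF t] by blast
    have "\<bar>Y (w t S) \<omega> - Y t0 \<omega>\<bar> \<le> W \<omega>"
      unfolding W_def j(2)[symmetric] using fin j(1) by (intro Max_ge) auto
    moreover have "\<bar>Y t \<omega> - Y (w t S) \<omega>\<bar> \<le> D \<omega>"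
      unfolding D_eq by (rule cSUP_upper[OF t D_bdd[OF \<omega>]])
    ultimately show "\<bar>Y t \<omega> - Y t0 \<omega>\<bar> \<le> W \<omega> + D \<omega>" by linarith
  qed (use t0 in auto)
  then have "(\<integral>\<^sup>+ \<omega>. ennreal (sup_norm_on T (\<lambda>t. avg_process X n \<omega> t - avg_process X n \<omega> t0)) \<partial>M)
      \<le> (\<integral>\<^sup>+ \<omega>. ennreal (W \<omega>) + ennreal (D \<omega>) \<partial>M)"
    by (intro nn_integral_mono) (simp add: ennreal_plus[symmetric] W_nonneg D_nonneg ennreal_leI
      del: ennreal_plus)
  also have "\<dots> = (\<integral>\<^sup>+ \<omega>. ennreal (W \<omega>) \<partial>M) + (\<integral>\<^sup>+ \<omega>. ennreal (D \<omega>) \<partial>M)"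
    by (rule nn_integral_add) auto
  also have "\<dots> \<le> ennreal (\<gamma> + a) + (\<integral>\<^sup>+ \<omega>. ennreal (D \<omega>) \<partial>M)"
    by (intro add_right_mono EW)
  finally show ?thesis
    by (simp add: \<gamma>_def a_def R_def D_def)
qed

end
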